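(* Let $n\ge2$ and let $\omega_0$ be the canonical metric on the standard Hopf manifold $\mathbb S^{2n-1}\times\mathbb S^1$. Then for each $t>0$ the Hermitian metric $$\omega_t=\omega_0+4\left(\frac{2(n-1)t}{n}-1\right)\sqrt{-1}\,\partial\bar\partial\log|z|^2$$ is $t$-Gauduchon-Ricci flat, that is, $\mathfrak{Ric}^{(1)}(\omega_t,t)=0$ for each $t>0$.
   Context: The standard Hopf manifold $\mathbb S^{2n-1}\times\mathbb S^1$ is $(\mathbb C^n\setminus\{0\})/G$, where $G$ is the cyclic group generated by $z\mapsto\frac12z$, with the complex structure $J$ induced from $\mathbb C^n\setminus\{0\}$. Its canonical metric is $\omega_0=\sqrt{-1}\,\frac{4\delta_{ij}}{|z|^2}dz^i\wedge d\bar z^j$. For a Hermitian metric $\omega=\sqrt{-1}h_{i\bar j}dz^i\wedge d\bar z^j$ with associated $J$-compatible Riemannian metric $g$ ($\omega(X,Y)=g(JX,Y)$, $h_{i\bar j}=g(\frac{\partial}{\partial z^i},\frac{\partial}{\partial\bar z^j})$ for $g$ extended $\mathbb C$-linearly), the Gauduchon connection $\nabla^t$ ($t\in\mathbb R$) is the real connection on the real tangent bundle defined by $g(\nabla^t_XY,Z)=g(\nabla^{\mathrm{LC}}_XY,Z)+\frac t2d\omega(JX,JY,JZ)+\frac{t-1}2d\omega(JX,Y,Z)$. Its complexification restricts to a connection $\nabla$ on $T^{1,0}$, with curvature $\mathfrak R_{i\bar jk\bar\ell}(\omega,t)=g\big((\nabla_i\nabla_{\bar j}-\nabla_{\bar j}\nabla_i)\frac{\partial}{\partial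 z^k},\frac{\partial}{\partial\bar z^\ell}\big)$, where $\nabla_i=\nabla_{\partial/\partial z^i}$, $\nabla_{\bar j}=\nabla_{\partial/\partial\bar z^j}$. Set $\mathfrak{Ric}^{(1)}(\omega,t)=\sqrt{-1}\,h^{k\bar\ell}\mathfrak R_{i\bar jk\bar\ell}(\omega,t)\,dz^i\wedge d\bar z^j$, with $(h^{i\bar j})$ the inverse matrix of $(h_{i\bar j})$. $\omega$ is $t$-Gauduchon-Ricci flat if $\mathfrak{Ric}^{(1)}(\omega,t)=0$. *)

theory Defs
  imports "HOL-Analysis.Analysis"
begin

section \<open>Forms and vector fields in complex coordinates\<close>

text \<open>
  Points and real tangent vectors of an open subset of complex n-space are both elements of
  \<open>complex ^ 'n\<close>: a vector \<open>v\<close> stands for the derivative in direction \<open>v\<close>, so that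
  \<open>v $ i\<close> is the value of \<open>dz\<^sup>i\<close> on it and the complex structure is multiplication by \<open>\<i>\<close>.
\<close>

type_synonym 'n vfield = "complex ^ 'n \<Rightarrow> complex ^ 'n"
type_synonym 'n form2 = "complex ^ 'n \<Rightarrow> complex ^ 'n \<Rightarrow> complex ^ 'n \<Rightarrow> complex"

definition J :: "complex ^ 'n::finite \<Rightarrow> complex ^ 'n" where
  "J v = \<i> *s v"

definition dir_deriv ::
  "('a::real_normed_vector \<Rightarrow> 'b::real_normed_vector) \<Rightarrow> 'a \<Rightarrow> 'a \<Rightarrow> 'b" where
  "dir_deriv f z v = frechet_derivative f (at z) v"

primrec Ck_on ::
  "nat \<Rightarrow> 'a::real_normed_vector set \<Rightarrow> ('a \<Rightarrow> 'b::real_normed_vector) \<Rightarrow> bool" where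
  "Ck_on 0 S f \<longleftrightarrow> continuous_on S f"
| "Ck_on (Suc k) S f \<longleftrightarrow>
     (\<forall>x\<in>S. f differentiable (at x)) \<and> (\<forall>v. Ck_on k S (\<lambda>x. dir_deriv f x v))"

definition smooth_on ::
  "'a::real_normed_vector set \<Rightarrow> ('a \<Rightarrow> 'b::real_normed_vector) \<Rightarrow> bool" where
  "smooth_on S f \<longleftrightarrow> (\<forall>k. Ck_on k S f)"

text \<open>The 2-form \<open>\<i> \<Sum> C\<^sub>i\<^sub>j dz\<^sup>i \<and> dzbar\<^sup>j\<close> (second index barred), evaluated on real tangent
  vectors.\<close>

definition form11 ::
  "complex ^ 'n ^ 'n \<Rightarrow> complex ^ 'n::finite \<Rightarrow> complex ^ 'n \<Rightarrow> complex" where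
  "form11 C X Y = \<i> * (\<Sum>i\<in>UNIV. \<Sum>j\<in>UNIV. C $ i $ j * (X $ i * cnj (Y $ j) - Y $ i * cnj (X $ j)))"

definition wirtinger :: "'n \<Rightarrow> (complex ^ 'n \<Rightarrow> complex) \<Rightarrow> complex ^ 'n::finite \<Rightarrow> complex" where
  "wirtinger i f z = (dir_deriv f z (axis i 1) - \<i> * dir_deriv f z (axis i \<i>)) / 2"

definition wirtinger_bar :: "'n \<Rightarrow> (complex ^ 'n \<Rightarrow> complex) \<Rightarrow> complex ^ 'n::finite \<Rightarrow> complex" where
  "wirtinger_bar j f z = (dir_deriv f z (axis j 1) + \<i> * dir_deriv f z (axis j \<i>)) / 2"

text \<open>\<open>\<i> \<Sum> (d\<^sup>2f / dz\<^sup>i dzbar\<^sup>j) dz\<^sup>i \<and> dzbar\<^sup>j\<close>\<close>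

definition i_ddbar :: "(complex ^ 'n \<Rightarrow> complex) \<Rightarrow> 'n::finite form2" where
  "i_ddbar f z = form11 (\<chi> i j. wirtinger i (wirtinger_bar j f) z)"

text \<open>Exterior derivative of a 2-form, without normalising factor. The vectors are extended to
  constant fields, so the bracket terms of the invariant formula vanish.\<close>

definition ext_deriv :: "'n::finite form2 \<Rightarrow> complex ^ 'n \<Rightarrow> complex ^ 'n \<Rightarrow> complex ^ 'n \<Rightarrow> complex ^ 'n \<Rightarrow> complex" where
  "ext_deriv \<omega> z X Y Z =
     dir_deriv (\<lambda>w. \<omega> w Y Z) z X - dir_deriv (\<lambda>w. \<omega> w X Z) z Y + dir_deriv (\<lambda>w. \<omega> w X Y) z Z"

definition lie_bracket :: "'n::finite vfield \<Rightarrow> 'n vfield \<Rightarrow> 'n vfield" where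
  "lie_bracket X Y z = dir_deriv Y z (X z) - dir_deriv X z (Y z)"

section \<open>Hermitian metrics and Gauduchon connections\<close>

text \<open>\<open>\<omega>(X,Y) = g(JX,Y)\<close>, hence \<open>g(X,Y) = \<omega>(X,JY)\<close>. Taking the real part only adjusts the
  type: the form of a Hermitian metric is required below to be real.\<close>

definition riem :: "'n::finite form2 \<Rightarrow> complex ^ 'n \<Rightarrow> complex ^ 'n \<Rightarrow> complex ^ 'n \<Rightarrow> real" where
  "riem \<omega> z X Y = Re (\<omega> z X (J Y))"

definition hermitian_metric_on :: "(complex ^ 'n::finite) set \<Rightarrow> 'n form2 \<Rightarrow> bool" where
  "hermitian_metric_on S \<omega> \<longleftrightarrow>
     (\<forall>z\<in>S. bilinear (\<omega> z) \<and>
        (\<forall>X Y. \<omega> z X Y \<in> \<real> \<and> \<omega> z Y X = - \<omega> z X Y \<and> \<omega> z (J X) (J Y) = \<omega> z X Y) \<and>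
        (\<forall>X. X \<noteq> 0 \<longrightarrow> riem \<omega> z X X > 0)) \<and>
     (\<forall>X Y. smooth_on S (\<lambda>z. \<omega> z X Y))"

text \<open>The Koszul expression for \<open>2 g(\<nabla>\<^sub>X Y, Z)\<close>; its value at \<open>z\<close> depends on \<open>Z\<close> only through
  \<open>Z z\<close>.\<close>

definition koszul :: "'n::finite form2 \<Rightarrow> 'n vfield \<Rightarrow> 'n vfield \<Rightarrow> 'n vfield \<Rightarrow> complex ^ 'n \<Rightarrow> real" where
  "koszul \<omega> X Y Z z =
     dir_deriv (\<lambda>w. riem \<omega> w (Y w) (Z w)) z (X z)
   + dir_deriv (\<lambda>w. riem \<omega> w (Z w) (X w)) z (Y z)
   - dir_deriv (\<lambda>w. riem \<omega> w (X w) (Y w)) z (Z z)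
   + riem \<omega> z (lie_bracket X Y z) (Z z)
   - riem \<omega> z (lie_bracket Y Z z) (X z)
   + riem \<omega> z (lie_bracket Z X z) (Y z)"

definition levi_civita :: "'n::finite form2 \<Rightarrow> 'n vfield \<Rightarrow> 'n vfield \<Rightarrow> 'n vfield" where
  "levi_civita \<omega> X Y z = (THE W. \<forall>Z. 2 * riem \<omega> z W Z = koszul \<omega> X Y (\<lambda>_. Z) z)"

definition gauduchon :: "'n::finite form2 \<Rightarrow> real \<Rightarrow> 'n vfield \<Rightarrow> 'n vfield \<Rightarrow> 'n vfield" where
  "gauduchon \<omega> t X Y z = (THE W. \<forall>Z. riem \<omega> z W Z =
       riem \<omega> z (levi_civita \<omega> X Y z) Z
     + t / 2 * Re (ext_deriv \<omega> z (J (X z)) (J (Y z)) (J Z))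
     + (t - 1) / 2 * Re (ext_deriv \<omega> z (J (X z)) (Y z) Z))"

section \<open>Complexification and curvature\<close>

text \<open>A complexified tangent vector \<open>a + \<i> b\<close>, with \<open>a\<close>, \<open>b\<close> real tangent vectors, is the pair
  \<open>(a, b)\<close>; this formal \<open>\<i>\<close> is distinct from \<open>J\<close>.\<close>

type_synonym 'n cvec = "(complex ^ 'n) \<times> (complex ^ 'n)"

definition riem_C :: "'n::finite form2 \<Rightarrow> complex ^ 'n \<Rightarrow> 'n cvec \<Rightarrow> 'n cvec \<Rightarrow> complex" where
  "riem_C \<omega> z U V =
     Complex (riem \<omega> z (fst U) (fst V) - riem \<omega> z (snd U) (snd V))
             (riem \<omega> z (fst U) (snd V) + riem \<omega> z (snd U) (fst V))"

definition gauduchon_C ::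
  "'n::finite form2 \<Rightarrow> real \<Rightarrow> (complex ^ 'n \<Rightarrow> 'n cvec) \<Rightarrow> (complex ^ 'n \<Rightarrow> 'n cvec) \<Rightarrow>
     complex ^ 'n \<Rightarrow> 'n cvec" where
  "gauduchon_C \<omega> t U V z =
     (gauduchon \<omega> t (fst \<circ> U) (fst \<circ> V) z - gauduchon \<omega> t (snd \<circ> U) (snd \<circ> V) z,
      gauduchon \<omega> t (fst \<circ> U) (snd \<circ> V) z + gauduchon \<omega> t (snd \<circ> U) (fst \<circ> V) z)"

text \<open>\<open>\<partial>/\<partial>z\<^sup>i = (\<partial>/\<partial>x\<^sup>i - \<i> \<partial>/\<partial>y\<^sup>i)/2\<close> and its conjugate, as constant fields\<close>

definition d_dz :: "'n \<Rightarrow> complex ^ 'n::finite \<Rightarrow> 'n cvec" where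
  "d_dz i = (\<lambda>_. ((1/2) *\<^sub>R axis i 1, - ((1/2) *\<^sub>R axis i \<i>)))"

definition d_dzbar :: "'n \<Rightarrow> complex ^ 'n::finite \<Rightarrow> 'n cvec" where
  "d_dzbar j = (\<lambda>_. ((1/2) *\<^sub>R axis j 1, (1/2) *\<^sub>R axis j \<i>))"

definition herm_matrix :: "'n::finite form2 \<Rightarrow> complex ^ 'n \<Rightarrow> complex ^ 'n ^ 'n" where
  "herm_matrix \<omega> z = (\<chi> i j. riem_C \<omega> z (d_dz i z) (d_dzbar j z))"

definition gauduchon_curv ::
  "'n::finite form2 \<Rightarrow> real \<Rightarrow> 'n \<Rightarrow> 'n \<Rightarrow> 'n \<Rightarrow> 'n \<Rightarrow> complex ^ 'n \<Rightarrow> complex" where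
  "gauduchon_curv \<omega> t i j k l z =
     riem_C \<omega> z
       (gauduchon_C \<omega> t (d_dz i) (gauduchon_C \<omega> t (d_dzbar j) (d_dz k)) z
        - gauduchon_C \<omega> t (d_dzbar j) (gauduchon_C \<omega> t (d_dz i) (d_dz k)) z)
       (d_dzbar l z)"

text \<open>The inverse \<open>h\<^sup>k\<^sup>l\<close> is normalised by \<open>\<Sum>\<^sub>l h\<^sup>k\<^sup>l h\<^sub>p\<^sub>l = \<delta>\<^sup>k\<^sub>p\<close> (\<open>l\<close> barred), so its \<open>k, l\<close>
  entry is the \<open>l, k\<close> entry of the inverse of the matrix with rows indexed by the unbarred index.\<close>

definition gauduchon_ricci1_matrix ::
  "'n::finite form2 \<Rightarrow> real \<Rightarrow> complex ^ 'n \<Rightarrow> complex ^ 'n ^ 'n" where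
  "gauduchon_ricci1_matrix \<omega> t z =
     (\<chi> i j. \<Sum>k\<in>UNIV. \<Sum>l\<in>UNIV. matrix_inv (herm_matrix \<omega> z) $ l $ k * gauduchon_curv \<omega> t i j k l z)"

definition gauduchon_ricci1 :: "'n::finite form2 \<Rightarrow> real \<Rightarrow> 'n form2" where
  "gauduchon_ricci1 \<omega> t z = form11 (gauduchon_ricci1_matrix \<omega> t z)"

section \<open>The standard Hopf manifold\<close>

definition hopf_group :: "(complex ^ 'n::finite \<Rightarrow> complex ^ 'n) set" where
  "hopf_group = range (\<lambda>(k::int) z. ((1/2) powi k) *\<^sub>R z)"

definition hopf_proj :: "complex ^ 'n::finite \<Rightarrow> (complex ^ 'n) set" where
  "hopf_proj z = (\<lambda>\<gamma>. \<gamma> z) ` hopf_group"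

definition hopf_manifold :: "(complex ^ 'n::finite) set set" where
  "hopf_manifold = hopf_proj ` (UNIV - {0})"

text \<open>The tangent bundle of the quotient is the quotient of the tangent bundle by the
  differentials of the deck transformations; these are linear, so each is its own differential.
  \<open>hopf_dproj z\<close> is the differential of the covering projection at \<open>z\<close>. As the projection is a
  local biholomorphism, tensors on the manifold, and everything computed from them in the charts
  inverse to it, are determined by their pullbacks to the covering space.\<close>

type_synonym 'n hopf_tangent = "((complex ^ 'n) \<times> (complex ^ 'n)) set"
type_synonym 'n hopf_form2 = "'n hopf_tangent \<Rightarrow> 'n hopf_tangent \<Rightarrow> complex"

definition hopf_dproj :: "complex ^ 'n::finite \<Rightarrow> complex ^ 'n \<Rightarrow> 'n hopf_tangent" where
  "hopf_dproj z v = (\<lambda>\<gamma>. (\<gamma> z, \<gamma> v)) ` hopf_group"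

definition hopf_tangent_space :: "(complex ^ 'n::finite) set \<Rightarrow> 'n hopf_tangent set" where
  "hopf_tangent_space p = {hopf_dproj z v | z v. z \<in> p}"

definition hopf_pullback :: "'n::finite hopf_form2 \<Rightarrow> 'n form2" where
  "hopf_pullback \<alpha> z X Y = \<alpha> (hopf_dproj z X) (hopf_dproj z Y)"

text \<open>The form on the quotient whose pullback is a given invariant form; only meaningful on pairs
  of tangent vectors at the same point.\<close>

definition hopf_descend :: "'n::finite form2 \<Rightarrow> 'n hopf_form2" where
  "hopf_descend \<alpha> A B =
     (THE c. \<forall>z X Y. z \<noteq> 0 \<and> A = hopf_dproj z X \<and> B = hopf_dproj z Y \<longrightarrow> c = \<alpha> z X Y)"

definition hopf_hermitian_metric :: "'n::finite hopf_form2 \<Rightarrow> bool" where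
  "hopf_hermitian_metric \<omega> \<longleftrightarrow> hermitian_metric_on (UNIV - {0}) (hopf_pullback \<omega>)"

definition hopf_gauduchon_ricci1 :: "'n::finite hopf_form2 \<Rightarrow> real \<Rightarrow> 'n hopf_form2" where
  "hopf_gauduchon_ricci1 \<omega> t = hopf_descend (gauduchon_ricci1 (hopf_pullback \<omega>) t)"

definition hopf_gauduchon_ricci_flat :: "real \<Rightarrow> 'n::finite hopf_form2 \<Rightarrow> bool" where
  "hopf_gauduchon_ricci_flat t \<omega> \<longleftrightarrow>
     (\<forall>p\<in>hopf_manifold. \<forall>A\<in>hopf_tangent_space p. \<forall>B\<in>hopf_tangent_space p.
        hopf_gauduchon_ricci1 \<omega> t A B = 0)"

definition hopf_omega0 :: "'n::finite hopf_form2" where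
  "hopf_omega0 =
     hopf_descend (\<lambda>z. form11 (\<chi> i j. if i = j then complex_of_real (4 / (norm z)\<^sup>2) else 0))"

text \<open>\<open>\<i> ddbar log |z|\<^sup>2\<close>: only this form, not the logarithm itself, descends to the quotient.\<close>

definition hopf_i_ddbar_log :: "'n::finite hopf_form2" where
  "hopf_i_ddbar_log = hopf_descend (i_ddbar (\<lambda>z. complex_of_real (ln ((norm z)\<^sup>2))))"

definition hopf_omega :: "real \<Rightarrow> 'n::finite hopf_form2" where
  "hopf_omega t A B = hopf_omega0 A B
     + complex_of_real (4 * (2 * (real CARD('n) - 1) * t / real CARD('n) - 1)) * hopf_i_ddbar_log A B"

end

theory Submission
  imports Defs
begin

text \<open>
  Write \<open>\<langle>X,Y\<rangle> = \<Sum>\<^sub>i X\<^sub>i cnj Y\<^sub>i\<close>, \<open>r = \<langle>z,z\<rangle>\<close> and \<open>a = 2(n-1)t/n\<close>. The metric has the Hermitian form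
  \<open>h(X,Y) = 4 (a \<langle>X,Y\<rangle>/r + (1-a) \<langle>X,z\<rangle>\<langle>z,Y\<rangle>/r\<^sup>2)\<close>, which is positive definite since \<open>a > 0\<close>.
  Its Gauduchon connection is \<open>D - t (T + T\<^sup>*) + \<Gamma>\<close>, where \<open>D\<close> is the flat connection, \<open>\<Gamma>\<close> is the
  Chern connection form, \<open>T\<close> its torsion and \<open>T\<^sup>*\<close> the \<open>h\<close>-adjoint of \<open>T\<close>; all are explicit. Since
  the connection is complex linear, the first Ricci form is the differential of the trace of its
  connection form, as the quadratic part has trace zero. That trace is
  \<open>- n \<langle>X,z\<rangle>/r + t (n-1)/(a r) (\<langle>X,z\<rangle> - \<langle>z,X\<rangle>)\<close>, and the value of \<open>a\<close> is exactly the one for which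
  it becomes the closed form \<open>-(n/2) d log r\<close>.
\<close>

section \<open>The standard Hermitian product\<close>

definition cip :: "complex ^ 'n::finite \<Rightarrow> complex ^ 'n \<Rightarrow> complex" where
  "cip x y = (\<Sum>i\<in>UNIV. x $ i * cnj (y $ i))"

lemma cip_add_left: "cip (x + y) z = cip x z + cip y z"
  by (simp add: cip_def sum.distrib algebra_simps)

lemma cip_add_right: "cip x (y + z) = cip x y + cip x z"
  by (simp add: cip_def sum.distrib algebra_simps)

lemma cip_scale_left: "cip (c *s x) y = c * cip x y"
  by (simp add: cip_def sum_distrib_left algebra_simps)

lemma cip_scale_right: "cip x (c *s y) = cnj c * cip x y"
  by (simp add: cip_def sum_distrib_left algebra_simps)

lemma scaleR_eq_smult: "r *\<^sub>R (x :: complex ^ 'n) = complex_of_real r *s x"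
  unfolding vec_eq_iff vector_scaleR_component by (simp add: scaleR_conv_of_real)

lemma cip_scaleR_left: "cip (r *\<^sub>R x) y = of_real r * cip x y"
  by (simp add: scaleR_eq_smult cip_scale_left)

lemma cip_scaleR_right: "cip x (r *\<^sub>R y) = of_real r * cip x y"
  by (simp add: scaleR_eq_smult cip_scale_right)

lemma cip_0 [simp]: "cip 0 y = 0" "cip x 0 = 0"
  by (simp_all add: cip_def)

lemma cip_minus [simp]: "cip (- x) y = - cip x y" "cip x (- y) = - cip x y"
  by (simp_all add: cip_def sum_negf)

lemma cip_J [simp]: "cip (J x) y = \<i> * cip x y" "cip x (J y) = - \<i> * cip x y"
  by (simp_all add: J_def cip_scale_left cip_scale_right)

lemmas cip_linear = cip_add_left cip_add_right cip_scale_left cip_scale_right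
  cip_scaleR_left cip_scaleR_right

lemma cnj_cip: "cnj (cip x y) = cip y x"
  by (simp add: cip_def mult.commute)

lemma cip_self: "cip x x = complex_of_real ((norm x)\<^sup>2)"
proof -
  have "(norm x)\<^sup>2 = (\<Sum>i\<in>UNIV. (cmod (x $ i))\<^sup>2)"
    by (simp add: norm_vec_def L2_set_def sum_nonneg)
  then show ?thesis
    by (simp only: cip_def of_real_sum complex_norm_square)
qed

lemma cip_self_eq_0_iff [simp]: "cip x x = 0 \<longleftrightarrow> x = 0"
  by (simp add: cip_self)

lemma cip_axis_right: "cip x (axis j 1) = x $ j"
  by (simp add: cip_def axis_def if_distrib [of cnj] if_distrib [of "(*) _"] cong: if_cong)

lemma cip_axis_left: "cip (axis j 1) x = cnj (x $ j)"
  by (metis cip_axis_right cnj_cip)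

text \<open>Conjugate linearity in the second slot is still real linearity, and in finite dimension
  a real bilinear map is bounded; this gives the product rule for derivatives.\<close>

lemma bounded_bilinear_cip: "bounded_bilinear (cip :: complex ^ 'n::finite \<Rightarrow> _)"
  unfolding bilinear_conv_bounded_bilinear [symmetric] bilinear_def
  by (auto intro!: linearI simp: cip_linear scaleR_conv_of_real [where 'a = complex])

lemma bounded_bilinear_smult:
  "bounded_bilinear (\<lambda>(c::complex) (v :: complex ^ 'n::finite). c *s v)"
  unfolding bilinear_conv_bounded_bilinear [symmetric] bilinear_def
  by (auto intro!: linearI simp: vec_eq_iff algebra_simps scaleR_conv_of_real [where 'a = complex])

lemmas has_derivative_cip [derivative_intros] =
  bounded_bilinear.FDERIV [OF bounded_bilinear_cip]
lemmas has_derivative_smult [derivative_intros] =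
  bounded_bilinear.FDERIV [OF bounded_bilinear_smult]

section \<open>Directional derivatives\<close>

lemma dir_deriv_eqI: "(f has_derivative f') (at z) \<Longrightarrow> dir_deriv f z v = f' v"
  by (simp add: dir_deriv_def frechet_derivative_at [symmetric])

lemma has_derivative_dir_deriv:
  "f differentiable (at z) \<Longrightarrow> (f has_derivative dir_deriv f z) (at z)"
  by (simp add: dir_deriv_def [abs_def] flip: frechet_derivative_works)

text \<open>At \<open>z\<close> both functions have the same set of derivatives, and
  \<open>frechet_derivative\<close> is a choice from that set, so the values agree even when the set
  is empty.\<close>

lemma dir_deriv_cong:
  assumes "open S" "z \<in> S" "\<And>w. w \<in> S \<Longrightarrow> f w = g w"
  shows "dir_deriv f z v = dir_deriv g z v"
proof -
  have "(f has_derivative D) (at z) \<longleftrightarrow> (g has_derivative D) (at z)" for D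
    using has_derivative_transform_within_open [OF _ assms(1,2), of f D UNIV g]
      has_derivative_transform_within_open [OF _ assms(1,2), of g D UNIV f] assms(3)
    by auto
  then show ?thesis
    by (simp add: dir_deriv_def frechet_derivative_def)
qed

section \<open>Functions of class C^k\<close>

lemma Ck_on_cong:
  assumes "open S" "\<And>x. x \<in> S \<Longrightarrow> f x = g x"
  shows "Ck_on k S f \<longleftrightarrow> Ck_on k S g"
  using assms(2)
proof (induction k arbitrary: f g)
  case 0
  then show ?case
    by (simp cong: continuous_on_cong)
next
  case (Suc k)
  have "f differentiable (at x) \<longleftrightarrow> g differentiable (at x)" if "x \<in> S" for x
    unfolding differentiable_def
    using has_derivative_transform_within_open [OF _ \<open>open S\<close> that, of f _ UNIV g]
      has_derivative_transform_within_open [OF _ \<open>open S\<close> that, of g _ UNIV f] Suc.prems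
    by metis
  moreover have "Ck_on k S (\<lambda>x. dir_deriv f x v) \<longleftrightarrow> Ck_on k S (\<lambda>x. dir_deriv g x v)" for v
    using Suc.prems by (intro Suc.IH dir_deriv_cong [OF \<open>open S\<close>])
  ultimately show ?case
    by auto
qed

text \<open>Replaces \<open>dir_deriv\<close> by an explicit derivative formula, so that the closure
  properties below follow from the usual differentiation rules by induction on
  \<open>k\<close>.\<close>

lemma Ck_on_SucI:
  assumes "open S" "\<And>x. x \<in> S \<Longrightarrow> (f has_derivative f' x) (at x)" "\<And>v. Ck_on k S (\<lambda>x. f' x v)"
  shows "Ck_on (Suc k) S f"
proof -
  have "dir_deriv f x v = f' x v" if "x \<in> S" for x v
    using assms(2) [OF that] by (rule dir_deriv_eqI)
  then have "Ck_on k S (\<lambda>x. dir_deriv f x v)" for v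
    using assms(3) [of v] Ck_on_cong [OF \<open>open S\<close>, of "\<lambda>x. dir_deriv f x v" "\<lambda>x. f' x v"] by simp
  then show ?thesis
    using assms(2) unfolding Ck_on.simps differentiable_def by blast
qed

text \<open>Serves the product and inverse rules, whose derivatives also contain the
  undifferentiated factors.\<close>

lemma Ck_on_SucD:
  assumes "Ck_on (Suc k) S f" shows "Ck_on k S f"
  using assms
proof (induction k arbitrary: f)
  case 0
  then show ?case
    by (auto intro!: continuous_at_imp_continuous_on differentiable_imp_continuous_within)
next
  case (Suc k)
  then show ?case
    by simp
qed

lemma Ck_on_has_derivative:
  assumes "Ck_on (Suc k) S f" "x \<in> S"
  shows "(f has_derivative dir_deriv f x) (at x)"
  using assms by (simp add: has_derivative_dir_deriv)

lemma Ck_on_const: "open S \<Longrightarrow> Ck_on k S (\<lambda>x. c)"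
  by (induction k arbitrary: c)
    (simp, rule Ck_on_SucI [where f' = "\<lambda>_ _. 0"], auto simp del: Ck_on.simps)

lemma Ck_on_add:
  assumes "open S" "Ck_on k S f" "Ck_on k S g"
  shows "Ck_on k S (\<lambda>x. f x + g x)"
  using assms(2,3)
proof (induction k arbitrary: f g)
  case 0
  then show ?case
    by (simp add: continuous_on_add)
next
  case (Suc k)
  show ?case
    by (rule Ck_on_SucI [OF \<open>open S\<close> has_derivative_add])
       (use Suc in \<open>auto intro: Ck_on_has_derivative\<close>)
qed

lemma Ck_on_mult:
  fixes f g :: "_ \<Rightarrow> 'b::real_normed_algebra"
  assumes "open S" "Ck_on k S f" "Ck_on k S g"
  shows "Ck_on k S (\<lambda>x. f x * g x)"
  using assms(2,3)
proof (induction k arbitrary: f g)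
  case 0
  then show ?case
    by (simp add: continuous_on_mult)
next
  case (Suc k)
  show ?case
    by (rule Ck_on_SucI [OF \<open>open S\<close> has_derivative_mult])
       (use Suc.prems Suc.IH [OF Ck_on_SucD [OF Suc.prems(1)]] Suc.IH [OF _ Ck_on_SucD [OF Suc.prems(2)]]
        in \<open>auto intro!: Ck_on_add [OF \<open>open S\<close>] intro: Ck_on_has_derivative\<close>)
qed

lemma Ck_on_bounded_linear:
  assumes "open S" "bounded_linear f"
  shows "Ck_on k S f"
proof (cases k)
  case 0
  then show ?thesis
    using assms by (simp add: linear_continuous_on)
next
  case (Suc l)
  then show ?thesis
    using Ck_on_SucI [OF \<open>open S\<close> bounded_linear_imp_has_derivative [OF assms(2)]]
    by (auto simp: Ck_on_const \<open>open S\<close>)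
qed

lemma Ck_on_inverse:
  fixes f :: "_ \<Rightarrow> 'b::real_normed_div_algebra"
  assumes "open S" "Ck_on k S f" "\<And>x. x \<in> S \<Longrightarrow> f x \<noteq> 0"
  shows "Ck_on k S (\<lambda>x. inverse (f x))"
  using assms(2)
proof (induction k)
  case 0
  then show ?case
    using assms(3) by (auto intro: continuous_on_inverse)
next
  case (Suc k)
  \<comment> \<open>The derivative of the inverse, with its sign written as a constant factor so
    that the product rule applies.\<close>
  have *: "Ck_on k S (\<lambda>x. - 1 * (inverse (f x) * dir_deriv f x v * inverse (f x)))" for v
    using Suc.IH [OF Ck_on_SucD [OF Suc.prems]] Suc.prems
    by (intro Ck_on_mult Ck_on_const \<open>open S\<close>) auto
  show ?case
    by (rule Ck_on_SucI [OF \<open>open S\<close> Deriv.has_derivative_inverse])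
       (use assms(3) * Suc.prems in \<open>auto intro: Ck_on_has_derivative\<close>)
qed

section \<open>The metric\<close>

text \<open>Kept polynomial in \<open>inverse (cip w w)\<close>: differentiation then needs only the
  product rule, and later identities become polynomial ones.\<close>

definition hherm :: "real \<Rightarrow> complex ^ 'n::finite \<Rightarrow> complex ^ 'n \<Rightarrow> complex ^ 'n \<Rightarrow> complex" where
  "hherm a w X Y = 4 * (a * cip X Y * inverse (cip w w)
     + (1 - a) * (cip X w * cip w Y) * (inverse (cip w w))\<^sup>2)"

text \<open>The derivative of \<open>hherm a w X Y\<close> in the base point \<open>w\<close>, in
  direction \<open>V\<close>, with \<open>X\<close> and \<open>Y\<close> held fixed.\<close>

definition hherm' :: "real \<Rightarrow> complex ^ 'n::finite \<Rightarrow> complex ^ 'n \<Rightarrow> complex ^ 'n \<Rightarrow> complex ^ 'n \<Rightarrow> complex" where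
  "hherm' a w V X Y = 4 *
     ((1 - a) * (cip X V * cip w Y + cip X w * cip V Y) * (inverse (cip w w))\<^sup>2
      - (cip V w + cip w V) * (a * cip X Y * (inverse (cip w w))\<^sup>2
          + 2 * (1 - a) * (cip X w * cip w Y) * (inverse (cip w w))^3))"

lemma has_derivative_inverse_cip:
  assumes "w \<noteq> 0"
  shows "((\<lambda>w. inverse (cip w w)) has_derivative
     (\<lambda>V. - (cip V w + cip w V) * (inverse (cip w w))\<^sup>2)) (at w)"
  using assms by (auto intro!: derivative_eq_intros simp: power2_eq_square algebra_simps)

lemma has_derivative_hherm:
  fixes w :: "complex ^ 'n::finite"
  assumes "w \<noteq> 0" "(X has_derivative X') (at w)" "(Y has_derivative Y') (at w)"
  shows "((\<lambda>w. hherm a w (X w) (Y w)) has_derivative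
     (\<lambda>V. hherm' a w V (X w) (Y w) + hherm a w (X' V) (Y w) + hherm a w (X w) (Y' V))) (at w)"
proof -
  \<comment> \<open>Naming the inverse makes the derivative rules treat it as a single factor with
    the derivative \<open>u\<close>.\<close>
  define u :: "complex ^ 'n \<Rightarrow> complex" where "u w = inverse (cip w w)" for w
  have u: "(u has_derivative (\<lambda>V. - (cip V w + cip w V) * (u w)\<^sup>2)) (at w)"
    unfolding u_def using assms(1) by (rule has_derivative_inverse_cip)
  show ?thesis
    unfolding hherm_def hherm'_def u_def [symmetric]
    apply (rule has_derivative_eq_rhs)
     apply (rule derivative_intros u assms)+
    apply (simp add: fun_eq_iff)
    apply (simp only: ring_distribs power2_eq_square power3_eq_cube)
    apply (simp add: ac_simps)
    done
qed

lemma Ck_on_cip: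
  fixes S :: "(complex ^ 'n::finite) set"
  assumes "open S" shows "Ck_on k S (\<lambda>w. cip w w)"
proof -
  have "Ck_on k S (\<lambda>w. \<Sum>i\<in>I. w $ i * cnj (w $ i))" if "finite I" for I :: "'n set"
    using that
  proof induction
    case empty
    then show ?case by (simp add: Ck_on_const assms)
  next
    case (insert i I)
    have "Ck_on k S (\<lambda>w. w $ i * cnj (w $ i))"
      by (intro Ck_on_mult Ck_on_bounded_linear assms
        bounded_linear_vec_nth bounded_linear_compose [OF bounded_linear_cnj])
    with insert show ?case by (simp add: Ck_on_add assms)
  qed
  then show ?thesis
    by (simp add: cip_def [abs_def])
qed

lemma Ck_on_hherm: "Ck_on k (UNIV - {0}) (\<lambda>w. hherm a w X Y)"
  unfolding hherm_def power2_eq_square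
  by (intro Ck_on_const Ck_on_add Ck_on_mult Ck_on_inverse Ck_on_cip Ck_on_bounded_linear
      bounded_bilinear.bounded_linear_left [OF bounded_bilinear_cip]
      bounded_bilinear.bounded_linear_right [OF bounded_bilinear_cip]) auto

lemma cnj_hherm: "cnj (hherm a w X Y) = hherm a w Y X"
  by (simp add: hherm_def cnj_cip mult.commute)

lemma hherm_linear:
  "hherm a w (X + Y) Z = hherm a w X Z + hherm a w Y Z"
  "hherm a w Z (X + Y) = hherm a w Z X + hherm a w Z Y"
  "hherm a w (c *s X) Z = c * hherm a w X Z"
  "hherm a w Z (c *s X) = cnj c * hherm a w Z X"
  by (simp_all add: hherm_def cip_linear algebra_simps)

lemma hherm_J [simp]:
  "hherm a w (J X) Z = \<i> * hherm a w X Z"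
  "hherm a w Z (J X) = - \<i> * hherm a w Z X"
  by (simp_all add: J_def hherm_linear)

lemma cip_Cauchy_Schwarz: "(cmod (cip X Y))\<^sup>2 \<le> (norm X)\<^sup>2 * (norm Y)\<^sup>2"
proof (cases "Y = 0")
  case False
  let ?c = "cip X Y / cip Y Y"
  \<comment> \<open>The component of \<open>X\<close> orthogonal to \<open>Y\<close>; the inequality
    says that its squared norm is nonnegative.\<close>
  let ?Z = "X + (- ?c) *s Y"
  have "cip ?Z ?Z * cip Y Y = cip X X * cip Y Y - cip X Y * cnj (cip X Y)"
  proof -
    have "cip ?Z Y = 0"
      unfolding cip_add_left cip_scale_left using False by simp
    then have "cip ?Z ?Z = cip ?Z X"
      unfolding cip_add_right [of ?Z] cip_scale_right by simp
    also have "\<dots> = cip X X - ?c * cip Y X"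
      by (simp only: cip_linear) simp
    finally show ?thesis
      using False by (simp add: cnj_cip field_simps)
  qed
  then have "complex_of_real ((norm ?Z)\<^sup>2 * (norm Y)\<^sup>2)
      = of_real ((norm X)\<^sup>2 * (norm Y)\<^sup>2 - (cmod (cip X Y))\<^sup>2)"
    by (simp only: cip_self of_real_mult of_real_diff complex_norm_square)
  then have "(norm ?Z)\<^sup>2 * (norm Y)\<^sup>2 = (norm X)\<^sup>2 * (norm Y)\<^sup>2 - (cmod (cip X Y))\<^sup>2"
    by (simp only: of_real_eq_iff)
  then show ?thesis
    by (metis diff_ge_0_iff_ge zero_le_mult_iff zero_le_power2)
qed simp

text \<open>With r = |w|^2 and q = |<X,w>|^2 the value is 4/r^2 (a (|X|^2 r - q) + q). Both summands
  are nonnegative by Cauchy-Schwarz, and they do not vanish together.\<close>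

lemma hherm_pos:
  assumes "a > 0" "w \<noteq> 0" "X \<noteq> 0"
  shows "Re (hherm a w X X) > 0"
proof -
  define r q where "r = (norm w)\<^sup>2" and "q = (cmod (cip X w))\<^sup>2"
  have "cip X w * cip w X = of_real q"
    unfolding q_def complex_norm_square by (simp add: cnj_cip)
  then have "Re (hherm a w X X) = 4 * (a * (norm X)\<^sup>2 / r + (1 - a) * q / r\<^sup>2)"
    by (simp add: hherm_def cip_self r_def divide_inverse power_inverse flip: of_real_power of_real_inverse)
  also have "\<dots> = 4 / r\<^sup>2 * (a * ((norm X)\<^sup>2 * r - q) + q)"
    using assms by (simp add: r_def field_simps power2_eq_square)
  also have "\<dots> > 0"
  proof -
    have r: "r > 0" and X: "(norm X)\<^sup>2 * r > 0" and q: "q \<ge> 0"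
      using assms by (auto simp: r_def q_def)
    have le: "q \<le> (norm X)\<^sup>2 * r"
      unfolding q_def r_def by (rule cip_Cauchy_Schwarz)
    have "a * ((norm X)\<^sup>2 * r - q) + q > 0"
    proof (cases "q = 0")
      case True
      then show ?thesis using X \<open>a > 0\<close> by simp
    next
      case False
      then show ?thesis using le q \<open>a > 0\<close>
        by (intro add_nonneg_pos) auto
    qed
    then show ?thesis using r by simp
  qed
  finally show ?thesis .
qed

section \<open>Descent of scale-invariant forms to the quotient\<close>

lemma hopf_dproj_eqD:
  assumes "hopf_dproj z X = hopf_dproj w Y"
  obtains k :: int where "w = ((1/2) powi k) *\<^sub>R z" "Y = ((1/2) powi k) *\<^sub>R X"
proof -
  have "(w, Y) \<in> hopf_dproj w Y"
    unfolding hopf_dproj_def hopf_group_def by (force intro: image_eqI [OF _ rangeI [of _ 0]])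
  then have "(w, Y) \<in> hopf_dproj z X"
    using assms by simp
  then show ?thesis
    using that by (auto simp: hopf_dproj_def hopf_group_def)
qed

text \<open>Any other representatives of the two tangent vectors over a common base point differ by
  one power of 1/2, under which the form is invariant; so the definite description is well
  defined.\<close>

lemma hopf_descend_eq:
  assumes inv: "\<And>c z X Y. z \<noteq> 0 \<Longrightarrow> c > 0 \<Longrightarrow> \<alpha> (c *\<^sub>R z) (c *\<^sub>R X) (c *\<^sub>R Y) = \<alpha> z X Y"
    and "z \<noteq> 0"
  shows "hopf_descend \<alpha> (hopf_dproj z X) (hopf_dproj z Y) = \<alpha> z X Y"
proof -
  have "\<alpha> w X' Y' = \<alpha> z X Y"
    if X: "hopf_dproj z X = hopf_dproj w X'" and Y: "hopf_dproj z Y = hopf_dproj w Y'" for w X' Y'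
  proof -
    obtain k :: int where k: "w = ((1/2) powi k) *\<^sub>R z" "X' = ((1/2) powi k) *\<^sub>R X"
      using X by (rule hopf_dproj_eqD)
    obtain l :: int where l: "w = ((1/2) powi l) *\<^sub>R z" "Y' = ((1/2) powi l) *\<^sub>R Y"
      using Y by (rule hopf_dproj_eqD)
    \<comment> \<open>Both powers carry the nonzero vector \<open>z\<close> to the same
      \<open>w\<close>.\<close>
    have "(1/2 :: real) powi k = (1/2) powi l"
      using k(1) l(1) \<open>z \<noteq> 0\<close> by (metis scaleR_cancel_right)
    with k l show ?thesis
      using inv [of z "(1/2) powi k" X Y] \<open>z \<noteq> 0\<close> by simp
  qed
  then show ?thesis
    unfolding hopf_descend_def using \<open>z \<noteq> 0\<close> by (intro the_equality) metis+
qed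

section \<open>The pullback of the metric in terms of \<open>hherm\<close>\<close>

lemma i_smult_axis: "axis i \<i> = \<i> *s axis i 1"
  by (simp add: vec_eq_iff axis_def)

lemma sum_delta_mult:
  "(\<Sum>i\<in>UNIV. \<Sum>j\<in>UNIV. (if i = j then c else 0) * (f i * g j)) = c * (\<Sum>i\<in>(UNIV::'n::finite set). f i * (g i :: complex))"
  by (simp add: if_distrib [of "\<lambda>x. x * _"] sum_distrib_left cong: if_cong)

text \<open>This shape of coefficients covers both summands of the metric: \<open>d = 0\<close>
  gives the canonical form, and the rank one term appears in the complex Hessian of log
  |z|^2.\<close>

lemma form11_eq_cip:
  "form11 (\<chi> i j. (if i = j then c else 0) + d * (cnj (w $ i) * w $ j)) X Y
     = \<i> * (c * (cip X Y - cip Y X) + d * (cip X w * cip w Y - cip Y w * cip w X))"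
proof -
  have *: "(\<Sum>i\<in>UNIV. \<Sum>j\<in>UNIV. d * (cnj (w $ i) * w $ j) * (U $ i * cnj (V $ j)))
      = d * (cip U w * cip w V)" for U V
    unfolding cip_def sum_product unfolding sum_distrib_left by (simp add: ac_simps)
  show ?thesis
    unfolding form11_def
    by (simp add: sum_subtractf ring_distribs sum.distrib sum_delta_mult * )
       (simp add: cip_def algebra_simps)
qed

lemma has_derivative_ln_norm:
  assumes "w \<noteq> 0"
  shows "((\<lambda>z. complex_of_real (ln ((norm z)\<^sup>2))) has_derivative
     (\<lambda>V. (cip V w + cip w V) * inverse (cip w w))) (at (w :: complex ^ 'n::finite))"
proof -
  have eq: "(norm z)\<^sup>2 = Re (cip z z)" for z :: "complex ^ 'n"
    by (simp add: cip_self)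
  define \<rho> where "\<rho> = Re (cip w w)"
  have "\<rho> > 0"
    using assms by (simp add: \<rho>_def cip_self)
  have "((\<lambda>z. Re (cip z z)) has_derivative (\<lambda>V. Re (cip w V + cip V w))) (at w)"
    by (rule bounded_linear.has_derivative [OF bounded_linear_Re])
      (rule derivative_intros has_derivative_ident)+
  then have "((\<lambda>z. complex_of_real (ln (Re (cip z z)))) has_derivative
     (\<lambda>V. of_real (Re (cip w V + cip V w) * inverse \<rho>))) (at w)"
    using \<open>\<rho> > 0\<close> unfolding \<rho>_def
    by (intro bounded_linear.has_derivative [OF bounded_linear_of_real] has_derivative_ln)
  moreover have "of_real (Re (cip w V + cip V w) * inverse \<rho>)
      = (cip V w + cip w V) * inverse (cip w w)" for V
  proof -
    have "cip w V + cip V w = of_real (Re (cip w V + cip V w))"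
      by (simp add: complex_eq_iff flip: cnj_cip [of w V])
    moreover have "cip w w = of_real \<rho>"
      by (simp add: cip_self \<rho>_def)
    ultimately show ?thesis
      by (metis add.commute of_real_inverse of_real_mult)
  qed
  ultimately show ?thesis
    unfolding eq by simp
qed

text \<open>The combination in \<open>wirtinger_bar\<close> cancels the complex linear term
  \<open>cip V w\<close> of the differential and keeps the conjugate linear term
  \<open>cip w V\<close>.\<close>

lemma wirtinger_bar_ln_norm:
  assumes "w \<noteq> 0"
  shows "wirtinger_bar j (\<lambda>z. complex_of_real (ln ((norm z)\<^sup>2))) w = w $ j * inverse (cip w w)"
  unfolding wirtinger_bar_def dir_deriv_eqI [OF has_derivative_ln_norm [OF assms]] i_smult_axis
  by (simp add: cip_linear cip_axis_left cip_axis_right algebra_simps)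

lemma i_ddbar_ln_norm:
  fixes w :: "complex ^ 'n::finite"
  assumes "w \<noteq> 0"
  shows "i_ddbar (\<lambda>z. complex_of_real (ln ((norm z)\<^sup>2))) w =
    form11 (\<chi> i j. (if i = j then inverse (cip w w) else 0)
      + - ((inverse (cip w w))\<^sup>2) * (cnj (w $ i) * w $ j))"
proof -
  have "wirtinger i (wirtinger_bar j (\<lambda>z. complex_of_real (ln ((norm z)\<^sup>2)))) w
     = (if i = j then inverse (cip w w) else 0) - (inverse (cip w w))\<^sup>2 * (cnj (w $ i) * w $ j)" for i j
  proof -
    let ?f = "\<lambda>z. z $ j * inverse (cip z z)"
    \<comment> \<open>The first derivative is known on the whole open complement of the origin, so
      its formula may be differentiated again.\<close>
    have "dir_deriv (wirtinger_bar j (\<lambda>z. complex_of_real (ln ((norm z)\<^sup>2)))) w V = dir_deriv ?f w V" for V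
      by (rule dir_deriv_cong [of "UNIV - {0}"]) (use assms wirtinger_bar_ln_norm in auto)
    moreover have "(?f has_derivative (\<lambda>V. V $ j * inverse (cip w w)
        - w $ j * (cip V w + cip w V) * (inverse (cip w w))\<^sup>2)) (at w)"
      by (rule has_derivative_eq_rhs, (rule derivative_intros has_derivative_inverse_cip assms
            bounded_linear_imp_has_derivative bounded_linear_vec_nth)+)
        (simp add: fun_eq_iff algebra_simps)
    moreover have "(axis i 1 :: complex ^ 'n) $ j = (if i = j then 1 else 0)"
      by (simp add: axis_def)
    ultimately show ?thesis
      unfolding wirtinger_def i_smult_axis
      by (simp add: dir_deriv_eqI cip_linear cip_axis_left cip_axis_right
          del: inverse_eq_divide) (auto simp: algebra_simps)
  qed
  then show ?thesis
    by (simp add: i_ddbar_def)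
qed

lemma i_ddbar_ln_norm_cip:
  "w \<noteq> 0 \<Longrightarrow> i_ddbar (\<lambda>z. complex_of_real (ln ((norm z)\<^sup>2))) w X Y =
    \<i> * (inverse (cip w w) * (cip X Y - cip Y X)
      + - ((inverse (cip w w))\<^sup>2) * (cip X w * cip w Y - cip Y w * cip w X))"
  by (subst i_ddbar_ln_norm, assumption) (simp only: form11_eq_cip)

text \<open>The coefficient of the Hessian term is 4(a - 1). Its diagonal part turns 4/r into 4a/r,
  and its rank one part contributes 4(1 - a)/r^2.\<close>

lemma hopf_pullback_omega:
  fixes z :: "complex ^ 'n::finite" and t :: real
  assumes "z \<noteq> 0"
  defines "a \<equiv> 2 * (real CARD('n) - 1) * t / real CARD('n)"
  shows "hopf_pullback (hopf_omega t) z X Y = \<i> * (hherm a z X Y - hherm a z Y X)"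
proof -
  let ?f0 = "\<lambda>z :: complex ^ 'n. form11 (\<chi> i j. if i = j then complex_of_real (4 / (norm z)\<^sup>2) else 0)"
  have f0: "?f0 z X Y = \<i> * (4 * inverse (cip z z) * (cip X Y - cip Y X))" for z X Y
    using form11_eq_cip [of "complex_of_real (4 / (norm z)\<^sup>2)" 0 0 X Y]
    by (simp add: cip_self divide_inverse)
  have "hopf_omega0 (hopf_dproj z X) (hopf_dproj z Y) = ?f0 z X Y"
    unfolding hopf_omega0_def
    by (rule hopf_descend_eq [OF _ \<open>z \<noteq> 0\<close>], unfold f0) (simp add: cip_linear field_simps)
  moreover have "hopf_i_ddbar_log (hopf_dproj z X) (hopf_dproj z Y)
      = i_ddbar (\<lambda>z. complex_of_real (ln ((norm z)\<^sup>2))) z X Y"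
    unfolding hopf_i_ddbar_log_def
    by (rule hopf_descend_eq [OF _ \<open>z \<noteq> 0\<close>])
       (simp add: i_ddbar_ln_norm_cip cip_linear del: of_real_power,
         simp add: field_simps power2_eq_square)
  moreover have "complex_of_real (4 * (2 * (real CARD('n) - 1) * t / real CARD('n) - 1))
      = 4 * (complex_of_real a - 1)"
    by (simp add: a_def)
  ultimately show ?thesis
    using \<open>z \<noteq> 0\<close>
    unfolding hopf_pullback_def hopf_omega_def f0
    by (simp add: i_ddbar_ln_norm_cip hherm_def) (simp add: algebra_simps)
qed

section \<open>The Gauduchon connection\<close>

text \<open>The part of the derivative of \<open>hherm a w Y Z\<close> in direction \<open>X\<close> that is complex linear in \<open>X\<close>;
  it determines the Chern connection.\<close>

definition chern_symb where
  "chern_symb a w X Y Z = 4 * ((1 - of_real a) * (cip X Z * cip Y w) * (inverse (cip w w))\<^sup>2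
     - cip X w * (a * cip Y Z * (inverse (cip w w))\<^sup>2
          + 2 * (1 - of_real a) * (cip Y w * cip w Z) * (inverse (cip w w))^3))"
  for a :: real and w X Y Z :: "complex ^ 'n::finite"

text \<open>Since the metric is Hermitian, the part of its derivative that is conjugate linear in
  \<open>V\<close> is the conjugate of the linear part with \<open>X\<close> and \<open>Y\<close>
  exchanged.\<close>

lemma hherm'_eq_chern_symb: "hherm' a w V X Y = chern_symb a w V X Y + cnj (chern_symb a w V Y X)"
  by (simp add: hherm'_def chern_symb_def cnj_cip algebra_simps)

lemma chern_symb_J [simp]:
  "chern_symb a w (J X) Y Z = \<i> * chern_symb a w X Y Z"
  "chern_symb a w X (J Y) Z = \<i> * chern_symb a w X Y Z"
  "chern_symb a w X Y (J Z) = - \<i> * chern_symb a w X Y Z"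
  by (simp_all add: chern_symb_def algebra_simps)

text \<open>The Chern connection form: the solution of
  \<open>hherm a w (chern a w X Y) Z = chern_symb a w X Y Z\<close>, with the inverse of the metric
  written out.\<close>

definition chern :: "real \<Rightarrow> complex ^ 'n::finite \<Rightarrow> complex ^ 'n \<Rightarrow> complex ^ 'n \<Rightarrow> complex ^ 'n" where
  "chern a w X Y = inverse (cip w w) *s ((of_real ((1 - a) / a) * cip Y w) *s X - cip X w *s Y
     - (of_real ((1 - a) / a) * inverse (cip w w) * cip X w * cip Y w) *s w)"

text \<open>The torsion \<open>chern a w X Y - chern a w Y X\<close>; the factor 1/a arises as 1 +
  (1 - a)/a.\<close>

definition tors :: "real \<Rightarrow> complex ^ 'n::finite \<Rightarrow> complex ^ 'n \<Rightarrow> complex ^ 'n \<Rightarrow> complex ^ 'n" where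
  "tors a w X Y = (inverse (cip w w) * of_real (1 / a)) *s (cip Y w *s X - cip X w *s Y)"

text \<open>For fixed \<open>X\<close>, the adjoint of \<open>Z \<mapsto> tors a w Z X\<close> with
  respect to \<open>hherm\<close>. The sum of \<open>tors a w X\<close> and
  \<open>tors_adj a w X\<close> is therefore skew-Hermitian.\<close>

definition tors_adj :: "real \<Rightarrow> complex ^ 'n::finite \<Rightarrow> complex ^ 'n \<Rightarrow> complex ^ 'n \<Rightarrow> complex ^ 'n" where
  "tors_adj a w X Y = inverse (cip w w) *s ((of_real (1 / a) * cip w X) *s Y
     - (cip Y X + of_real ((1 - a) / a) * inverse (cip w w) * cip w X * cip Y w) *s w)"

lemma cip_diff: "cip (x - y) z = cip x z - cip y z" "cip z (x - y) = cip z x - cip z y"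
  by (simp_all add: cip_def sum_subtractf algebra_simps)

lemmas cip_cnj_simps = complex_cnj_diff complex_cnj_mult complex_cnj_power complex_cnj_inverse
  complex_cnj_add complex_cnj_complex_of_real complex_cnj_numeral complex_cnj_one cnj_cip

context
  fixes a :: real and w :: "complex ^ 'n::finite"
  assumes a: "a \<noteq> 0" and w: "w \<noteq> 0"
begin

lemma hherm_chern:
  "hherm a w (chern a w X Y) Z = chern_symb a w X Y Z"
proof -
  \<comment> \<open>With these scalars as atoms, the claim is a polynomial identity modulo the three
    relations shown next. The two lemmas that follow are proved in the same way.\<close>
  define r u b c where "r = cip w w" and "u = inverse (cip w w)"
    and "b = complex_of_real ((1 - a) / a)" and "c = complex_of_real (1 / a)"
  have "r * u = 1" "of_real a * b = 1 - of_real a" "of_real a * c = 1"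
    using a w by (simp_all add: r_def u_def b_def c_def field_simps)
  then show ?thesis
    unfolding hherm_def chern_def chern_symb_def cip_linear cip_diff 
    unfolding u_def [symmetric] b_def [symmetric] c_def [symmetric]
    unfolding r_def [symmetric]
    by algebra
qed

lemma hherm_tors:
  "hherm a w (tors a w X Y) Z = chern_symb a w X Y Z - chern_symb a w Y X Z"
proof -
  define r u b c where "r = cip w w" and "u = inverse (cip w w)"
    and "b = complex_of_real ((1 - a) / a)" and "c = complex_of_real (1 / a)"
  have "r * u = 1" "of_real a * b = 1 - of_real a" "of_real a * c = 1"
    using a w by (simp_all add: r_def u_def b_def c_def field_simps)
  then show ?thesis
    unfolding hherm_def tors_def chern_symb_def cip_linear cip_diff 
    unfolding u_def [symmetric] b_def [symmetric] c_def [symmetric]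
    unfolding r_def [symmetric]
    by algebra
qed

lemma hherm_tors_adj:
  "hherm a w (tors_adj a w X Y) Z = cnj (chern_symb a w Z X Y - chern_symb a w X Z Y)"
proof -
  define r u b c where "r = cip w w" and "u = inverse (cip w w)"
    and "b = complex_of_real ((1 - a) / a)" and "c = complex_of_real (1 / a)"
  have "r * u = 1" "of_real a * b = 1 - of_real a" "of_real a * c = 1"
    using a w by (simp_all add: r_def u_def b_def c_def field_simps)
  then show ?thesis
    unfolding hherm_def tors_adj_def chern_symb_def cip_linear cip_diff cip_cnj_simps
    unfolding u_def [symmetric] b_def [symmetric] c_def [symmetric]
    unfolding r_def [symmetric]
    by algebra
qed

end

text \<open>The connection form of the Gauduchon connection relative to the flat one;
  \<open>t = 0\<close> gives the Chern connection.\<close>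

definition conn :: "real \<Rightarrow> real \<Rightarrow> complex ^ 'n::finite \<Rightarrow> complex ^ 'n \<Rightarrow> complex ^ 'n \<Rightarrow> complex ^ 'n" where
  "conn a t w X Y = chern a w X Y - of_real t *s (tors a w X Y + tors_adj a w X Y)"

section \<open>The Levi-Civita and Gauduchon connections\<close>

lemma hherm_diff: "hherm a w (X - Y) Z = hherm a w X Z - hherm a w Y Z"
  by (simp add: hherm_def cip_diff algebra_simps)

lemma hherm_0 [simp]: "hherm a w 0 X = 0" "hherm a w X 0 = 0"
  by (simp_all add: hherm_def)

lemma hherm_minus [simp]: "hherm a w (- X) Z = - hherm a w X Z"
  by (simp add: hherm_def)

text \<open>The parameter \<open>a\<close> is kept independent of \<open>t\<close>: the formulas for
  the connections hold for every positive \<open>a\<close>, and the relation between the two enters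
  only through the trace.\<close>

locale hopf_form =
  fixes \<omega> :: "'n::finite form2" and a :: real
  assumes a_pos: "a > 0"
    and \<omega>_eq: "z \<noteq> 0 \<Longrightarrow> \<omega> z X Y = \<i> * (hherm a z X Y - hherm a z Y X)"
begin

lemma riem_eq: "z \<noteq> 0 \<Longrightarrow> riem \<omega> z X Y = 2 * Re (hherm a z X Y)"
  by (simp add: riem_def \<omega>_eq algebra_simps flip: cnj_hherm [of a z X Y])

text \<open>Nondegeneracy, tested on \<open>V - W\<close>. It provides the uniqueness required by
  the definite descriptions of both connections.\<close>

lemma riem_eqI:
  assumes "z \<noteq> 0" "\<And>Z. riem \<omega> z V Z = riem \<omega> z W Z"
  shows "V = W"
proof (rule ccontr)
  assume "V \<noteq> W"
  then have "Re (hherm a z (V - W) (V - W)) > 0"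
    using a_pos \<open>z \<noteq> 0\<close> by (intro hherm_pos) auto
  then show False
    using assms(2) [of "V - W"] \<open>z \<noteq> 0\<close> by (simp add: riem_eq hherm_diff)
qed

lemma dir_deriv_riem:
  assumes "z \<noteq> 0" "(X has_derivative X') (at z)" "(Y has_derivative Y') (at z)"
  shows "dir_deriv (\<lambda>w. riem \<omega> w (X w) (Y w)) z V
    = 2 * Re (hherm' a z V (X z) (Y z) + hherm a z (X' V) (Y z) + hherm a z (X z) (Y' V))"
proof -
  have "dir_deriv (\<lambda>w. riem \<omega> w (X w) (Y w)) z V = dir_deriv (\<lambda>w. 2 * Re (hherm a w (X w) (Y w))) z V"
    by (rule dir_deriv_cong [of "UNIV - {0}"]) (auto simp: riem_eq \<open>z \<noteq> 0\<close>)
  then show ?thesis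
    by (simp add: dir_deriv_eqI [OF has_derivative_mult_right [OF bounded_linear.has_derivative
            [OF bounded_linear_Re has_derivative_hherm [OF assms]]]])
qed

lemma dir_deriv_form:
  assumes "z \<noteq> 0"
  shows "dir_deriv (\<lambda>w. \<omega> w X Y) z V = \<i> * (hherm' a z V X Y - hherm' a z V Y X)"
proof -
  have "dir_deriv (\<lambda>w. \<omega> w X Y) z V = dir_deriv (\<lambda>w. \<i> * (hherm a w X Y - hherm a w Y X)) z V"
    by (rule dir_deriv_cong [of "UNIV - {0}"]) (auto simp: \<omega>_eq assms)
  also have "\<dots> = \<i> * (hherm' a z V X Y - hherm' a z V Y X)"
    using dir_deriv_eqI [OF has_derivative_mult_right [OF has_derivative_diff
       [OF has_derivative_hherm has_derivative_hherm]], OF assms has_derivative_const has_derivative_const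
         assms has_derivative_const has_derivative_const, of \<i> a X Y a Y X V]
    by simp
  finally show ?thesis .
qed

lemma koszul_eq:
  assumes "z \<noteq> 0" "(Y has_derivative Y') (at z)"
  shows "koszul \<omega> (\<lambda>_. X) Y (\<lambda>_. Z) z = 4 * Re (hherm a z (Y' X) Z)
     + 2 * Re (hherm' a z X (Y z) Z + hherm' a z (Y z) Z X - hherm' a z Z X (Y z))"
proof -
  have dY: "dir_deriv Y z V = Y' V" for V
    using assms(2) by (rule dir_deriv_eqI)
  have dc: "dir_deriv (\<lambda>_. V) z U = 0" for U V :: "complex ^ 'n"
    by (rule dir_deriv_eqI) (rule has_derivative_const)
  have Re_comm: "Re (hherm a z U V) = Re (hherm a z V U)" for U V
    by (metis cnj_hherm cnj.sel(1))
  show ?thesis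
    unfolding koszul_def lie_bracket_def dY dc
      dir_deriv_riem [OF assms(1) has_derivative_const assms(2)]
      dir_deriv_riem [OF assms(1) assms(2) has_derivative_const]
      dir_deriv_riem [OF assms(1) has_derivative_const has_derivative_const]
      riem_eq [OF assms(1)]
    \<comment> \<open>The derivative \<open>Y' Z\<close> occurs in the term differentiated along
      \<open>Z\<close> and in the bracket of \<open>Y\<close> with \<open>Z\<close>; the two
      contributions cancel by symmetry of the real part.\<close>
    using Re_comm [of X "Y' Z"]
    by (simp add: hherm_diff)
qed

text \<open>The correction removes the Chern torsion: \<open>tors\<close> is antisymmetric in its
  two arguments, while the two \<open>tors_adj\<close> terms together are symmetric. The Koszul
  formula is checked by splitting each \<open>hherm'\<close> into \<open>chern_symb\<close>
  parts.\<close>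

lemma levi_civita_eq:
  assumes "z \<noteq> 0" "(Y has_derivative Y') (at z)"
  shows "levi_civita \<omega> (\<lambda>_. X) Y z = Y' X + chern a z X (Y z)
    - (1/2) *s (tors a z X (Y z) + tors_adj a z X (Y z) + tors_adj a z (Y z) X)" (is "_ = ?W")
proof -
  have "2 * riem \<omega> z ?W Z = koszul \<omega> (\<lambda>_. X) Y (\<lambda>_. Z) z" for Z
    using a_pos assms
    by (simp add: koszul_eq riem_eq hherm_diff hherm_linear hherm_chern hherm_tors hherm_tors_adj
        hherm'_eq_chern_symb)
      (simp add: field_simps)
  then show ?thesis
    unfolding levi_civita_def
    by (intro the_equality riem_eqI [OF assms(1)]) (auto, metis mult_cancel_left zero_neq_numeral)
qed

text \<open>The part of the d\<omega> terms free of \<open>t\<close> cancels the torsion correction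
  of the Levi-Civita connection, including \<open>tors_adj a z (Y z) X\<close>, the only term
  conjugate linear in \<open>Y z\<close>. What remains is complex linear in the differentiated
  field.\<close>

lemma gauduchon_eq:
  assumes "z \<noteq> 0" "(Y has_derivative Y') (at z)"
  shows "gauduchon \<omega> t (\<lambda>_. X) Y z = Y' X + conn a t z X (Y z)" (is "_ = ?W")
proof -
  have "riem \<omega> z ?W Z = riem \<omega> z (levi_civita \<omega> (\<lambda>_. X) Y z) Z
     + t / 2 * Re (ext_deriv \<omega> z (J X) (J (Y z)) (J Z))
     + (t - 1) / 2 * Re (ext_deriv \<omega> z (J X) (Y z) Z)" for Z
    using a_pos assms
    by (simp add: levi_civita_eq ext_deriv_def dir_deriv_form conn_def
        riem_eq hherm_diff hherm_linear hherm_chern hherm_tors hherm_tors_adj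
        hherm'_eq_chern_symb)
      (simp add: field_simps)
  then show ?thesis
    unfolding gauduchon_def
    by (intro the_equality riem_eqI [OF assms(1)]) auto
qed

end

section \<open>The connection form as a complex matrix, and its trace\<close>

lemma conn_linear:
  "conn a t w X (Y + Z) = conn a t w X Y + conn a t w X Z"
  "conn a t w X (c *s Y) = c *s conn a t w X Y"
  unfolding conn_def chern_def tors_def tors_adj_def
  by (simp_all add: vec_eq_iff cip_linear algebra_simps del: of_real_divide of_real_diff)

lemma conn_minus: "conn a t w X (- Y) = - conn a t w X Y"
  using conn_linear(2) [of a t w X "- 1" Y] by simp

lemma conn_J: "conn a t w X (J Y) = J (conn a t w X Y)"
  by (simp add: J_def conn_linear)

lemma conn_component:
  fixes V :: "complex ^ 'n::finite"
  shows "conn a t w X V $ k = (\<Sum>m\<in>UNIV. V $ m * conn a t w X (axis m 1) $ k)"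
proof -
  have "linear (conn a t w X)"
    by (rule linearI) (simp_all only: conn_linear scaleR_eq_smult)
  then have "conn a t w X (\<Sum>m\<in>UNIV. V $ m *s axis m 1) = (\<Sum>m\<in>UNIV. V $ m *s conn a t w X (axis m 1))"
    by (simp only: linear_sum conn_linear)
  then show ?thesis
    by (simp only: basis_expansion) simp
qed

text \<open>The identity tr(AB) = tr(BA) for the matrices of the connection form.\<close>

lemma trace_conn_comp_commute:
  "(\<Sum>k\<in>UNIV. conn a t w X (conn a t w Y (axis k 1)) $ k)
    = (\<Sum>k\<in>UNIV. conn a t w Y (conn a t w X (axis k 1)) $ k)"
  by (subst (1 2) conn_component, subst sum.swap) (simp add: mult.commute)

text \<open>The derivative itself stays anonymous; its trace is recovered later by differentiating
  \<open>trace_conn\<close>.\<close>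

lemma conn_differentiable:
  assumes "z \<noteq> 0"
  shows "(\<lambda>w. conn a t w X V) differentiable (at z)"
  unfolding differentiable_def conn_def chern_def tors_def tors_adj_def
  by (rule exI) (rule has_derivative_inverse_cip [OF assms] derivative_intros)+

lemma has_derivative_conn:
  "z \<noteq> 0 \<Longrightarrow> ((\<lambda>w. conn a t w X V) has_derivative dir_deriv (\<lambda>w. conn a t w X V) z) (at z)"
  by (intro has_derivative_dir_deriv conn_differentiable)

lemma trace_conn:
  fixes w :: "complex ^ 'n::finite"
  assumes "w \<noteq> 0" "a \<noteq> 0" and a: "a = 2 * (real CARD('n) - 1) * t / real CARD('n)"
  shows "(\<Sum>k\<in>UNIV. conn a t w X (axis k 1) $ k)
    = of_real (- real CARD('n) / 2) * (cip X w + cip w X) * inverse (cip w w)"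
proof -
  define n where "n = complex_of_real (real CARD('n))"
  define r u b c where "r = cip w w" and "u = inverse (cip w w)"
    and "b = complex_of_real ((1 - a) / a)" and "c = complex_of_real (1 / a)"
  \<comment> \<open>The first two facts are traces of rank one maps
    \<open>Y \<mapsto> cip Y w *s V\<close> and \<open>Y \<mapsto> cip Y X *s V\<close>; the third
    is the trace of the identity.\<close>
  have 1: "(\<Sum>k\<in>UNIV. cip (axis k 1) w * V $ k) = cip V w" for V
    by (simp only: cip_axis_left) (simp add: cip_def mult.commute)
  have 2: "(\<Sum>k\<in>UNIV. cip (axis k 1) X * V $ k) = cip V X" for V
    by (simp only: cip_axis_left) (simp add: cip_def mult.commute)
  have 3: "(\<Sum>k\<in>(UNIV :: 'n set). axis k (1::complex) $ k) = n"
    by (simp add: axis_def n_def)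
  have chern: "(\<Sum>k\<in>UNIV. chern a w X (axis k 1) $ k)
      = u * (b * cip X w - cip X w * n - b * u * cip X w * r)"
    using 1 [of X] 1 [of w] 3
    unfolding chern_def u_def [symmetric] b_def [symmetric]
    by (simp add: sum_subtractf sum.distrib r_def mult.assoc flip: sum_distrib_left)
      (simp add: algebra_simps)
  have tors: "(\<Sum>k\<in>UNIV. tors a w X (axis k 1) $ k) = u * c * (cip X w - cip X w * n)"
    using 1 [of X] 3
    unfolding tors_def u_def [symmetric] c_def [symmetric]
    by (simp add: sum_subtractf mult.assoc flip: sum_distrib_left)
      (simp add: algebra_simps)
  have tors_adj: "(\<Sum>k\<in>UNIV. tors_adj a w X (axis k 1) $ k)
      = u * (c * cip w X * n - (cip w X + b * u * cip w X * r))"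
    using 2 [of w] 1 [of w] 3
    unfolding tors_adj_def u_def [symmetric] b_def [symmetric] c_def [symmetric]
    by (simp add: sum_subtractf sum.distrib r_def mult.assoc ring_distribs flip: sum_distrib_left)
  have rels: "r * u = 1" "of_real a * b = 1 - of_real a" "of_real a * c = 1"
    using assms(1,2) by (simp_all add: r_def u_def b_def c_def field_simps)
  \<comment> \<open>Here the choice of \<open>a\<close> enters: t(n - 1)/a = n/2, which makes the
    coefficients of \<open>cip X w\<close> and \<open>cip w X\<close> both equal to -n/2 times the
    inverse of \<open>cip w w\<close>.\<close>
  have "a * real CARD('n) = 2 * (real CARD('n) - 1) * t"
    using a by (simp add: field_simps)
  then have "complex_of_real (a * real CARD('n)) = of_real (2 * (real CARD('n) - 1) * t)"
    by simp
  then have n: "of_real a * n = 2 * (n - 1) * of_real t"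
    by (simp add: n_def)
  define h where "h = complex_of_real (- real CARD('n) / 2)"
  have h: "2 * h = - n"
    by (simp add: n_def h_def)
  have "(\<Sum>k\<in>UNIV. conn a t w X (axis k 1) $ k)
     = u * (b * cip X w - cip X w * n - b * u * cip X w * r)
       - of_real t * (u * c * (cip X w - cip X w * n)
         + u * (c * cip w X * n - (cip w X + b * u * cip w X * r)))"
    by (simp add: conn_def sum_subtractf sum.distrib ring_distribs chern tors tors_adj
        flip: sum_distrib_left)
  \<comment> \<open>Doubling lets the relation \<open>2 * h = - n\<close> replace a division, so the
    identity is polynomial.\<close>
  moreover have "2 * \<dots> = 2 * (h * (cip X w + cip w X) * u)"
    using rels n h by algebra
  ultimately show ?thesis
    unfolding h_def [symmetric] u_def [symmetric] by (simp only: mult_cancel_left) simp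
qed

section \<open>The curvature\<close>

text \<open>The value at \<open>z\<close> of \<open>\<nabla>\<^sub>X \<nabla>\<^sub>Y V\<close> for constant fields.\<close>

definition conn_sq :: "real \<Rightarrow> real \<Rightarrow> complex ^ 'n::finite \<Rightarrow> complex ^ 'n \<Rightarrow> complex ^ 'n \<Rightarrow> complex ^ 'n \<Rightarrow> complex ^ 'n" where
  "conn_sq a t z X Y V = dir_deriv (\<lambda>w. conn a t w Y V) z X + conn a t z X (conn a t z Y V)"

lemma conn_sq_scale: "z \<noteq> 0 \<Longrightarrow> conn_sq a t z X Y (c *s V) = c *s conn_sq a t z X Y V"
proof -
  assume "z \<noteq> 0"
  from has_derivative_conn [OF this]
  have "((\<lambda>w. c *s conn a t w Y V) has_derivative (\<lambda>X. c *s dir_deriv (\<lambda>w. conn a t w Y V) z X)) (at z)"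
    by (rule bounded_linear.has_derivative [OF bounded_bilinear.bounded_linear_right
            [OF bounded_bilinear_smult]])
  then show ?thesis
    by (simp add: conn_sq_def conn_linear dir_deriv_eqI vector_add_ldistrib)
qed

text \<open>The quadratic part is symmetric because the trace of a product is. The derivative part
  is a second derivative of -(n/2) log |z|^2, symmetric since the trace form is exact.\<close>

lemma trace_conn_sq_commute:
  fixes z :: "complex ^ 'n::finite"
  assumes "z \<noteq> 0" "a \<noteq> 0" and a: "a = 2 * (real CARD('n) - 1) * t / real CARD('n)"
  shows "(\<Sum>k\<in>UNIV. conn_sq a t z X Y (axis k 1) $ k) = (\<Sum>k\<in>UNIV. conn_sq a t z Y X (axis k 1) $ k)"
proof -
  define h where "h = complex_of_real (- real CARD('n) / 2)"
  have deriv: "(\<Sum>k\<in>UNIV. dir_deriv (\<lambda>w. conn a t w Y (axis k 1)) z X $ k)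
    = h *
       ((cip Y X + cip X Y) * inverse (cip z z)
        - (cip Y z + cip z Y) * (cip X z + cip z X) * (inverse (cip z z))\<^sup>2)" (is "?l X Y = ?r X Y") for X Y
  proof -
    let ?D = "\<lambda>X. \<Sum>k\<in>UNIV. dir_deriv (\<lambda>w. conn a t w Y (axis k 1)) z X $ k"
    have "((\<lambda>w. \<Sum>k\<in>UNIV. conn a t w Y (axis k 1) $ k) has_derivative ?D) (at z)"
      by (intro has_derivative_sum bounded_linear.has_derivative [OF bounded_linear_vec_nth]
          has_derivative_conn \<open>z \<noteq> 0\<close>)
    then have "((\<lambda>w. h * (cip Y w + cip w Y) * inverse (cip w w))
        has_derivative ?D) (at z)"
      by (rule has_derivative_transform_within_open [of _ _ _ _ "UNIV - {0}"])
        (rule open_delete [OF open_UNIV], simp add: \<open>z \<noteq> 0\<close>, rule trace_conn [OF _ \<open>a \<noteq> 0\<close> a, folded h_def], simp)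
    moreover have "((\<lambda>w. h * (cip Y w + cip w Y) * inverse (cip w w))
        has_derivative (\<lambda>X. ?r X Y)) (at z)"
      by (rule has_derivative_eq_rhs, (rule has_derivative_inverse_cip [OF assms(1)] derivative_intros)+)
        (simp add: fun_eq_iff algebra_simps)
    \<comment> \<open>The trace is differentiated once termwise and once through its closed form;
      uniqueness of the derivative identifies the results.\<close>
    ultimately have "?D = (\<lambda>X. ?r X Y)"
      by (rule has_derivative_unique)
    then show ?thesis
      by (rule fun_cong)
  qed
  have "(\<Sum>k\<in>UNIV. dir_deriv (\<lambda>w. conn a t w Y (axis k 1)) z X $ k)
      = (\<Sum>k\<in>UNIV. dir_deriv (\<lambda>w. conn a t w X (axis k 1)) z Y $ k)"
    unfolding deriv by (simp add: algebra_simps)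
  then show ?thesis
    by (simp add: conn_sq_def sum.distrib trace_conn_comp_commute [of a t z X Y])
qed

lemma hherm_axis_expand: "hherm a w V Y = (\<Sum>p\<in>UNIV. V $ p * hherm a w (axis p 1) Y)"
  for V :: "complex ^ 'n::finite"
proof -
  have "linear (\<lambda>V. hherm a w V Y)"
    by (rule linearI) (simp_all add: hherm_linear scaleR_eq_smult scaleR_conv_of_real [where 'a = complex])
  then have "hherm a w (\<Sum>m\<in>UNIV. V $ m *s axis m 1) Y = (\<Sum>m\<in>UNIV. V $ m * hherm a w (axis m 1) Y)"
    by (simp only: linear_sum [of "\<lambda>V. hherm a w V Y"] hherm_linear)
  then show ?thesis
    by (simp only: basis_expansion)
qed

section \<open>Fields of type (1,0), complexified curvature and its trace\<close>

lemma half_scaleR_axis: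
  "(1/2) *\<^sub>R (axis k 1 :: complex ^ 'n::finite) = (1/2) *s axis k 1"
  "(1/2) *\<^sub>R (axis k \<i> :: complex ^ 'n::finite) = J ((1/2) *s axis k 1)"
  by (simp_all add: scaleR_eq_smult i_smult_axis J_def vec_eq_iff)

lemma J_linear: "J (x + y) = J x + J y" "J (x - y) = J x - J y" "J (- x) = - J x" "J (J x) = - x"
  by (simp_all add: J_def vec_eq_iff algebra_simps)

lemma bounded_linear_J: "bounded_linear (J :: complex ^ 'n::finite \<Rightarrow> _)"
  unfolding J_def [abs_def]
  by (rule bounded_bilinear.bounded_linear_right [OF bounded_bilinear_smult])

context hopf_form
begin

text \<open>Pairs \<open>(V, - J V)\<close> are the vectors of type (1,0), on which the formal
  imaginary unit acts as \<open>J\<close>. The connection preserves this shape because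
  \<open>conn\<close> commutes with \<open>J\<close>. The shape of \<open>G\<close> is assumed only
  off the origin, where iterated covariant derivatives are computed.\<close>

lemma gauduchon_C_eq:
  assumes "z \<noteq> 0" "(V has_derivative V') (at z)" "\<And>w. w \<noteq> 0 \<Longrightarrow> G w = (V w, - J (V w))"
  shows "gauduchon_C \<omega> t (\<lambda>_. (X, Y)) G z =
    (let P = V' X + conn a t z X (V z) + J (V' Y + conn a t z Y (V z)) in (P, - J P))"
proof -
  have "(fst \<circ> G has_derivative V') (at z)"
    by (rule has_derivative_transform_within_open [OF assms(2), of "UNIV - {0}"]) (use assms in auto)
  then have 1: "gauduchon \<omega> t (\<lambda>_. X) (fst \<circ> G) z = V' X + conn a t z X (V z)" for X
    using assms(1,3) by (simp add: gauduchon_eq)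
  have "((\<lambda>w. - J (V w)) has_derivative (\<lambda>X. - J (V' X))) (at z)"
    by (intro has_derivative_minus bounded_linear.has_derivative [OF bounded_linear_J] assms)
  then have "(snd \<circ> G has_derivative (\<lambda>X. - J (V' X))) (at z)"
    by (rule has_derivative_transform_within_open [of _ _ _ _ "UNIV - {0}"]) (use assms in auto)
  then have 2: "gauduchon \<omega> t (\<lambda>_. X) (snd \<circ> G) z = - J (V' X + conn a t z X (V z))" for X
    using assms(1,3) by (simp add: gauduchon_eq conn_minus conn_J J_linear)
  have 3: "fst \<circ> (\<lambda>_. (X, Y)) = (\<lambda>_. X)" "snd \<circ> (\<lambda>_. (X, Y)) = (\<lambda>_. Y)"
    by auto
  show ?thesis
    by (simp only: gauduchon_C_def 1 2 3) (simp add: Let_def J_linear)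
qed

text \<open>Although \<open>riem\<close> sees only the real part of \<open>hherm\<close>, its
  complex bilinear extension recovers the full complex value when a (1,0) vector is paired with a
  (0,1) vector.\<close>

lemma riem_C_d_dzbar:
  "z \<noteq> 0 \<Longrightarrow> riem_C \<omega> z (W, - J W) (d_dzbar l z) = 2 * hherm a z W (axis l 1)"
  by (simp add: riem_C_def d_dzbar_def half_scaleR_axis riem_eq hherm_linear complex_eq_iff)

lemma d_dz_eq: "d_dz k = (\<lambda>_. ((1/2) *s axis k 1, - J ((1/2) *s axis k 1)))"
  by (simp add: d_dz_def half_scaleR_axis)

lemma d_dzbar_eq: "d_dzbar k = (\<lambda>_. ((1/2) *s axis k 1, J ((1/2) *s axis k 1)))"
  by (simp add: d_dzbar_def half_scaleR_axis)

lemma herm_matrix_eq: "z \<noteq> 0 \<Longrightarrow> herm_matrix \<omega> z $ k $ l = hherm a z (axis k 1) (axis l 1)"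
  by (simp add: herm_matrix_def d_dz_eq riem_C_d_dzbar hherm_linear)

text \<open>A vector \<open>x\<close> in the kernel of the transpose satisfies
  \<open>hherm a z x x = 0\<close>, against positive definiteness.\<close>

lemma invertible_herm_matrix:
  assumes "z \<noteq> 0"
  shows "invertible (herm_matrix \<omega> z)"
proof -
  have "x = 0" if "transpose (herm_matrix \<omega> z) *v x = 0" for x
  proof (rule ccontr)
    assume "x \<noteq> 0"
    have "hherm a z x (axis l 1) = 0" for l
      using arg_cong [OF that, of "\<lambda>v. v $ l"] assms
      by (subst hherm_axis_expand)
        (simp add: matrix_vector_mult_def transpose_def herm_matrix_eq mult.commute)
    then have "hherm a z (axis l 1) x = 0" for l
      by (metis cnj_hherm complex_cnj_zero)
    then have "hherm a z x x = 0"
      by (subst hherm_axis_expand) simp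
    then show False
      using hherm_pos [OF a_pos assms \<open>x \<noteq> 0\<close>] by simp
  qed
  then have "\<exists>B. B ** transpose (herm_matrix \<omega> z) = mat 1"
    by (simp add: matrix_left_invertible_ker)
  then show ?thesis
    by (simp add: left_invertible_transpose invertible_right_inverse)
qed

lemma gauduchon_C_const:
  assumes "w \<noteq> 0"
  shows "gauduchon_C \<omega> t (\<lambda>_. (X, Y)) (\<lambda>_. (V, - J V)) w
    = (let P = conn a t w X V + J (conn a t w Y V) in (P, - J P))"
  using gauduchon_C_eq [OF assms has_derivative_const [of V], of "\<lambda>_. (V, - J V)" t X Y]
  by simp

text \<open>Complex bilinear expansion in the two directions; each formal imaginary unit becomes a
  \<open>J\<close>, and two of them give the minus sign.\<close>

lemma gauduchon_C_twice:
  assumes "z \<noteq> 0"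
  shows "gauduchon_C \<omega> t (\<lambda>_. (X, Y)) (gauduchon_C \<omega> t (\<lambda>_. (X', Y')) (\<lambda>_. (V, - J V))) z
    = (let P = conn_sq a t z X X' V + J (conn_sq a t z X Y' V)
             + J (conn_sq a t z Y X' V) - conn_sq a t z Y Y' V in (P, - J P))"
proof -
  have "((\<lambda>w. conn a t w X' V + J (conn a t w Y' V)) has_derivative
    (\<lambda>U. dir_deriv (\<lambda>w. conn a t w X' V) z U + J (dir_deriv (\<lambda>w. conn a t w Y' V) z U))) (at z)"
    by (intro has_derivative_add bounded_linear.has_derivative [OF bounded_linear_J]
        has_derivative_conn assms)
  from gauduchon_C_eq [OF assms this, of _ t X Y] show ?thesis
    by (simp add: gauduchon_C_const Let_def conn_sq_def conn_linear conn_J J_linear algebra_simps)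
qed

lemma gauduchon_ricci1_matrix_eq_0:
  assumes "z \<noteq> 0" and a: "a = 2 * (real CARD('n) - 1) * t / real CARD('n)"
  shows "gauduchon_ricci1_matrix \<omega> t z $ i $ j = 0"
proof -
  let ?M = "herm_matrix \<omega> z"
  \<comment> \<open>Real and imaginary parts of the coordinate fields with indices \<open>i\<close>
    and, barred, \<open>j\<close>. These are constant and commute, so \<open>R\<close> is the real
    curvature operator and \<open>W\<close> its complex bilinear extension.\<close>
  define X Y X' Y' :: "complex ^ 'n" where
    "X = (1/2) *s axis i 1" "Y = - J X" "X' = (1/2) *s axis j 1" "Y' = J X'"
  define R where "R U U' V = conn_sq a t z U U' V - conn_sq a t z U' U V" for U U' V
  define W where "W V = R X X' V + J (R X Y' V) + J (R Y X' V) - R Y Y' V" for V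
  have curv: "gauduchon_curv \<omega> t i j k l z = 2 * hherm a z (W ((1/2) *s axis k 1)) (axis l 1)" for k l
  proof -
    have "d_dz i = (\<lambda>_. (X, Y))" "d_dzbar j = (\<lambda>_. (X', Y'))"
      by (simp_all add: X_Y_X'_Y'_def d_dz_eq d_dzbar_eq)
    then have "gauduchon_curv \<omega> t i j k l z = riem_C \<omega> z
        (W ((1/2) *s axis k 1), - J (W ((1/2) *s axis k 1))) (d_dzbar l z)"
      unfolding gauduchon_curv_def d_dz_eq [of k]
      by (intro arg_cong [where f = "\<lambda>U. riem_C \<omega> z U _"])
        (simp add: gauduchon_C_twice [OF assms(1)] Let_def W_def R_def J_linear algebra_simps)
    then show ?thesis
      using assms(1) by (simp add: riem_C_d_dzbar)
  qed
  have "?M ** matrix_inv ?M = mat 1"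
    using invertible_herm_matrix [OF assms(1)] unfolding invertible_def matrix_inv_def
    by (rule someI2_ex) simp
  then have inv: "(\<Sum>l\<in>UNIV. ?M $ p $ l * matrix_inv ?M $ l $ k) = (if p = k then 1 else 0)" for p k
    by (simp add: matrix_matrix_mult_def mat_def vec_eq_iff)
  \<comment> \<open>Contraction with the inverse metric turns the pairing with the basis vectors
    back into a component, so the Ricci coefficient is a trace of \<open>W\<close>.\<close>
  have contr: "(\<Sum>l\<in>UNIV. matrix_inv ?M $ l $ k * hherm a z V (axis l 1)) = V $ k" for V k
  proof -
    have "(\<Sum>l\<in>UNIV. matrix_inv ?M $ l $ k * hherm a z V (axis l 1))
      = (\<Sum>p\<in>UNIV. V $ p * (\<Sum>l\<in>UNIV. ?M $ p $ l * matrix_inv ?M $ l $ k))"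
      by (subst hherm_axis_expand, simp only: sum_distrib_left, subst sum.swap)
        (simp add: herm_matrix_eq assms(1) ac_simps)
    then show ?thesis
      unfolding inv by (simp add: if_distrib [of "\<lambda>x. _ * x"] cong: if_cong)
  qed
  have R: "(\<Sum>k\<in>UNIV. R U U' ((1/2) *s axis k 1) $ k) = 0" for U U'
    using trace_conn_sq_commute [OF assms(1) _ a, of U U'] a_pos
    by (simp add: R_def conn_sq_scale assms(1) sum_subtractf flip: sum_divide_distrib)
  have "gauduchon_ricci1_matrix \<omega> t z $ i $ j = (\<Sum>k\<in>UNIV. 2 * W ((1/2) *s axis k 1) $ k)"
    by (simp add: gauduchon_ricci1_matrix_def curv mult.left_commute contr flip: sum_distrib_left)
  also have "\<dots> = 0"
    \<comment> \<open>Under the trace each \<open>J\<close> becomes a factor \<open>\<i>\<close>, so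
      every term is a multiple of a vanishing trace of \<open>R\<close>.\<close>
    by (simp add: W_def J_def sum.distrib sum_subtractf R flip: sum_distrib_left)
  finally show ?thesis .
qed

lemma gauduchon_ricci1_eq_0:
  assumes "z \<noteq> 0" "a = 2 * (real CARD('n) - 1) * t / real CARD('n)"
  shows "gauduchon_ricci1 \<omega> t z X Y = 0"
  by (simp add: gauduchon_ricci1_def form11_def gauduchon_ricci1_matrix_eq_0 [OF assms])

lemma hermitian_metric: "hermitian_metric_on (UNIV - {0}) \<omega>"
proof -
  have eq: "\<omega> z X Y = of_real (- 2 * Im (hherm a z X Y))" if "z \<noteq> 0" for z X Y
    by (simp add: \<omega>_eq [OF that] complex_eq_iff flip: cnj_hherm [of a z X Y])
  have "bilinear (\<omega> z)" if "z \<noteq> 0" for z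
    unfolding bilinear_def
    by (auto intro!: linearI simp: \<omega>_eq that hherm_linear scaleR_eq_smult algebra_simps
        scaleR_conv_of_real [where 'a = complex])
  moreover have "smooth_on (UNIV - {0}) (\<lambda>z. \<omega> z X Y)" for X Y
  proof -
    have "Ck_on k (UNIV - {0}) (\<lambda>z. \<i> * (hherm a z X Y + (- 1) * hherm a z Y X))" for k
      by (intro Ck_on_mult Ck_on_add Ck_on_const Ck_on_hherm) auto
    then show ?thesis
      unfolding smooth_on_def
      by (subst Ck_on_cong [of _ _ "\<lambda>z. \<i> * (hherm a z X Y + (- 1) * hherm a z Y X)"])
        (auto simp: \<omega>_eq)
  qed
  moreover have "\<omega> z X Y \<in> \<real>" if "z \<noteq> 0" for z X Y
    unfolding eq [OF that] by (rule Reals_of_real)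
  moreover have "\<omega> z Y X = - \<omega> z X Y" "\<omega> z (J X) (J Y) = \<omega> z X Y" if "z \<noteq> 0" for z X Y
    by (simp_all add: \<omega>_eq that algebra_simps)
  moreover have "riem \<omega> z X X > 0" if "z \<noteq> 0" "X \<noteq> 0" for z X
    using hherm_pos [OF a_pos that] by (simp add: riem_eq [OF that(1)])
  ultimately show ?thesis
    unfolding hermitian_metric_on_def by blast
qed

end

section \<open>Passage to the Hopf manifold\<close>

text \<open>Two tangent vectors at one point of the quotient may be represented over different
  points of the orbit; this moves one of them to the base point of the other.\<close>

lemma hopf_dproj_translate:
  fixes w :: "complex ^ 'n::finite"
  assumes "z \<in> hopf_proj w" "z' \<in> hopf_proj w"
  obtains Y' where "hopf_dproj z' Y = hopf_dproj z Y'"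
proof -
  obtain k l :: int where k: "z = ((1/2) powi k) *\<^sub>R w" and l: "z' = ((1/2) powi l) *\<^sub>R w"
    using assms by (auto simp: hopf_proj_def hopf_group_def)
  define m where "m = k - l"
  have *: "z = ((1/2) powi m) *\<^sub>R z'"
    by (simp add: k l m_def power_int_diff)
  \<comment> \<open>Reindexing the orbit by a shift of the exponent leaves it unchanged as a
    set.\<close>
  have range_shift: "range f = range (\<lambda>p. f (p + m))" for f :: "int \<Rightarrow> (complex ^ 'n) \<times> (complex ^ 'n)"
    unfolding set_eq_iff image_iff by (metis UNIV_I diff_add_cancel)
  have "hopf_dproj z' Y = range (\<lambda>p :: int. (((1/2) powi p) *\<^sub>R z', ((1/2) powi p) *\<^sub>R Y))"
    by (simp add: hopf_dproj_def hopf_group_def image_image)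
  also have "\<dots> = range (\<lambda>p :: int. (((1/2) powi p) *\<^sub>R z, ((1/2) powi p) *\<^sub>R ((1/2) powi m) *\<^sub>R Y))"
    unfolding * by (subst range_shift) (simp add: power_int_add)
  also have "\<dots> = hopf_dproj z (((1/2) powi m) *\<^sub>R Y)"
    by (simp add: hopf_dproj_def hopf_group_def image_image)
  finally have "hopf_dproj z' Y = hopf_dproj z (((1/2) powi m) *\<^sub>R Y)" .
  then show ?thesis
    using that by blast
qed

theorem theorem1p11:
  fixes t :: real
  assumes "CARD('n::finite) \<ge> 2" and "t > 0"
  shows "hopf_hermitian_metric (hopf_omega t :: 'n hopf_form2) \<and>
         hopf_gauduchon_ricci_flat t (hopf_omega t :: 'n hopf_form2)"
proof -
  define a where "a = 2 * (real CARD('n) - 1) * t / real CARD('n)"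
  \<comment> \<open>Positivity of \<open>a\<close> comes from \<open>n \<ge> 2\<close> and
    \<open>t > 0\<close>.\<close>
  interpret hopf_form "hopf_pullback (hopf_omega t :: 'n hopf_form2)" a
    using assms by unfold_locales (simp_all add: a_def hopf_pullback_omega)
  let ?Ric = "gauduchon_ricci1 (hopf_pullback (hopf_omega t :: 'n hopf_form2)) t"
  have "hopf_descend ?Ric A B = 0"
    if pAB: "p \<in> hopf_manifold" "A \<in> hopf_tangent_space p" "B \<in> hopf_tangent_space p" for p A B
  proof -
    obtain w where w: "w \<noteq> 0" "p = hopf_proj w"
      using pAB(1) by (auto simp: hopf_manifold_def)
    obtain z z' X Y where z: "z \<in> hopf_proj w" "z' \<in> hopf_proj w"
      and A: "A = hopf_dproj z X" and B: "B = hopf_dproj z' Y"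
      using pAB(2,3) by (auto simp: hopf_tangent_space_def w(2))
    obtain Y' where Y': "B = hopf_dproj z Y'"
      using hopf_dproj_translate [OF z] B by metis
    have "z \<noteq> 0"
      using z(1) w(1) by (auto simp: hopf_proj_def hopf_group_def)
    then show ?thesis
      \<comment> \<open>On the covering space the Ricci form vanishes off the origin, hence is scale
        invariant there and descends to zero.\<close>
      unfolding A Y' by (subst hopf_descend_eq) (simp_all add: gauduchon_ricci1_eq_0 a_def)
  qed
  then show ?thesis
    using hermitian_metric
    by (simp add: hopf_hermitian_metric_def hopf_gauduchon_ricci_flat_def hopf_gauduchon_ricci1_def)
qed

end
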